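(* Let $l {\,\simeq\,} r \lor C$ and $L[t] \lor D$ be clauses of first-order logic with equality, where $l,r$ are terms, $C$ and $D$ are clauses, and $L[t]$ is a literal containing a particular occurrence of the term $t$. Let $\sigma$ be a substitution such that (1) $l\sigma = t$, (2) $C\sigma \subseteq_M D$, (3) $l\sigma \succ r\sigma$, and (4) $L[t] \lor D \succ (l {\,\simeq\,} r)\sigma \lor C\sigma$. Then subsumption demodulation $$\frac{l {\,\simeq\,} r \lor C \qquad L[t] \lor D}{L[r\sigma] \lor D}$$ is a simplification inference whose main premise $L[t]\lor D$ becomes redundant: $L[t] \lor D$ is a logical consequence of $L[r\sigma] \lor D$ and $l {\,\simeq\,} r \lor C$ (via its instance $(l {\,\simeq\,} r)\sigma \lor C\sigma$), and $L[t]\lor D$ is strictly greater w.r.t. $\succ$ than both $L[r\sigma] \lor D$ and $(l {\,\simeq\,} r)\sigma \lor C\sigma$.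
   Context: Clauses are finite multisets of literals, read as disjunctions with variables implicitly universally quantified; $\subseteq_M$ denotes multiset inclusion. For an expression $E$, $E[s]$ denotes $E$ with a particular occurrence of a term $s$, and $E[s']$ denotes the result of replacing that occurrence by $s'$. $E\sigma$ denotes the result of applying substitution $\sigma$. The symbol $\succ$ is a fixed simplification ordering on terms (a well-founded strict partial order that is stable under substitutions, monotonic w.r.t. term contexts, and has the subterm property), extended to literals and clauses via the multiset extension; on literals, a negative literal is greater than its positive counterpart, if $L_1 \succ L_2$ for positive $L_1,L_2$ then $\neg L_1 \succ L_1 \succ \neg L_2 \succ L_2$, and equality literals are smaller than any literal with a predicate symbol other than equality. A clause $C$ is redundant in a set $S$ of clauses if there are clauses $C_1,\dots,C_n$ (from $S$) with $C \succ C_i$ for all $i$ and $C_1,\dots,C_n \models C$. A simplification inference is one in which a premise (the main premise) becomes redundant once the conclusion is added. *)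

theory Defs
  imports "HOL-Library.Multiset" "HOL-Library.Uprod"
begin

section \<open>Syntax\<close>

text \<open>Symbols carry no arity: \<open>f\<close> applied to \<open>m\<close> and to \<open>n \<noteq> m\<close> arguments counts as two distinct
  symbols. The same convention applies to predicate symbols.\<close>

datatype ('f, 'v) "term" =
  Var 'v
| Fun 'f "('f, 'v) term list"

type_synonym ('f, 'v) subst = "'v \<Rightarrow> ('f, 'v) term"

primrec subst_term :: "('f, 'v) subst \<Rightarrow> ('f, 'v) term \<Rightarrow> ('f, 'v) term" where
  "subst_term \<sigma> (Var x) = \<sigma> x"
| "subst_term \<sigma> (Fun f ts) = Fun f (map (subst_term \<sigma>) ts)"

text \<open>Equations are unordered: \<open>s \<simeq> t\<close> and \<open>t \<simeq> s\<close> are the same atom.\<close>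

datatype ('f, 'p, 'v) atom =
  Eq "('f, 'v) term uprod"
| Pred 'p "('f, 'v) term list"

datatype ('f, 'p, 'v) literal =
  Pos "('f, 'p, 'v) atom"
| Neg "('f, 'p, 'v) atom"

type_synonym ('f, 'p, 'v) clause = "('f, 'p, 'v) literal multiset"

abbreviation equation :: "('f, 'v) term \<Rightarrow> ('f, 'v) term \<Rightarrow> ('f, 'p, 'v) literal" where
  "equation s t \<equiv> Pos (Eq (Upair s t))"

primrec subst_atom :: "('f, 'v) subst \<Rightarrow> ('f, 'p, 'v) atom \<Rightarrow> ('f, 'p, 'v) atom" where
  "subst_atom \<sigma> (Eq e) = Eq (map_uprod (subst_term \<sigma>) e)"
| "subst_atom \<sigma> (Pred p ts) = Pred p (map (subst_term \<sigma>) ts)"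

primrec subst_literal :: "('f, 'v) subst \<Rightarrow> ('f, 'p, 'v) literal \<Rightarrow> ('f, 'p, 'v) literal" where
  "subst_literal \<sigma> (Pos A) = Pos (subst_atom \<sigma> A)"
| "subst_literal \<sigma> (Neg A) = Neg (subst_atom \<sigma> A)"

definition subst_clause :: "('f, 'v) subst \<Rightarrow> ('f, 'p, 'v) clause \<Rightarrow> ('f, 'p, 'v) clause" where
  "subst_clause \<sigma> C = image_mset (subst_literal \<sigma>) C"

text \<open>A term or literal with a distinguished occurrence of a subterm is a context with one hole;
  replacing that occurrence amounts to filling the same context with another term.\<close>

datatype ('f, 'v) ctxt =
  Hole
| More 'f "('f, 'v) term list" "('f, 'v) ctxt" "('f, 'v) term list"

primrec fill_ctxt :: "('f, 'v) ctxt \<Rightarrow> ('f, 'v) term \<Rightarrow> ('f, 'v) term" where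
  "fill_ctxt Hole t = t"
| "fill_ctxt (More f ts c us) t = Fun f (ts @ fill_ctxt c t # us)"

datatype ('f, 'p, 'v) atom_ctxt =
  Eq_ctxt "('f, 'v) ctxt" "('f, 'v) term"
| Pred_ctxt 'p "('f, 'v) term list" "('f, 'v) ctxt" "('f, 'v) term list"

primrec fill_atom_ctxt :: "('f, 'p, 'v) atom_ctxt \<Rightarrow> ('f, 'v) term \<Rightarrow> ('f, 'p, 'v) atom" where
  "fill_atom_ctxt (Eq_ctxt c u) t = Eq (Upair (fill_ctxt c t) u)"
| "fill_atom_ctxt (Pred_ctxt p ts c us) t = Pred p (ts @ fill_ctxt c t # us)"

datatype ('f, 'p, 'v) literal_ctxt =
  Pos_ctxt "('f, 'p, 'v) atom_ctxt"
| Neg_ctxt "('f, 'p, 'v) atom_ctxt"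

primrec fill_literal_ctxt ::
  "('f, 'p, 'v) literal_ctxt \<Rightarrow> ('f, 'v) term \<Rightarrow> ('f, 'p, 'v) literal" where
  "fill_literal_ctxt (Pos_ctxt a) t = Pos (fill_atom_ctxt a t)"
| "fill_literal_ctxt (Neg_ctxt a) t = Neg (fill_atom_ctxt a t)"


section \<open>Semantics\<close>

text \<open>An interpretation is given by its domain, the type \<open>'u\<close>, and the interpretations \<open>F\<close> and \<open>P\<close>
  of the function and predicate symbols. The symbol \<open>\<simeq>\<close> is interpreted as identity.\<close>

primrec eval_term :: "('f \<Rightarrow> 'u list \<Rightarrow> 'u) \<Rightarrow> ('v \<Rightarrow> 'u) \<Rightarrow> ('f, 'v) term \<Rightarrow> 'u" where
  "eval_term F v (Var x) = v x"
| "eval_term F v (Fun f ts) = F f (map (eval_term F v) ts)"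

primrec atom_true ::
  "('f \<Rightarrow> 'u list \<Rightarrow> 'u) \<Rightarrow> ('p \<Rightarrow> 'u list \<Rightarrow> bool) \<Rightarrow> ('v \<Rightarrow> 'u) \<Rightarrow> ('f, 'p, 'v) atom \<Rightarrow> bool" where
  "atom_true F P v (Eq e) \<longleftrightarrow> (\<exists>s t. e = Upair s t \<and> eval_term F v s = eval_term F v t)"
| "atom_true F P v (Pred p ts) \<longleftrightarrow> P p (map (eval_term F v) ts)"

primrec literal_true ::
  "('f \<Rightarrow> 'u list \<Rightarrow> 'u) \<Rightarrow> ('p \<Rightarrow> 'u list \<Rightarrow> bool) \<Rightarrow> ('v \<Rightarrow> 'u) \<Rightarrow> ('f, 'p, 'v) literal \<Rightarrow> bool" where
  "literal_true F P v (Pos A) \<longleftrightarrow> atom_true F P v A"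
| "literal_true F P v (Neg A) \<longleftrightarrow> \<not> atom_true F P v A"

definition clause_valid ::
  "('f \<Rightarrow> 'u list \<Rightarrow> 'u) \<Rightarrow> ('p \<Rightarrow> 'u list \<Rightarrow> bool) \<Rightarrow> ('f, 'p, 'v) clause \<Rightarrow> bool" where
  "clause_valid F P C \<longleftrightarrow> (\<forall>v. \<exists>L \<in># C. literal_true F P v L)"

text \<open>HOL cannot quantify over types inside a formula, so the domain type is an explicit parameter.
  Consequence in the usual sense is \<open>entails TYPE('u) N C\<close> for all \<open>'u\<close>, which is what a theorem
  schematic in \<open>'u\<close> expresses.\<close>

definition entails ::
  "'u itself \<Rightarrow> ('f, 'p, 'v) clause set \<Rightarrow> ('f, 'p, 'v) clause \<Rightarrow> bool" where
  "entails _ N C \<longleftrightarrow>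
    (\<forall>(F :: 'f \<Rightarrow> 'u list \<Rightarrow> 'u) P. (\<forall>E \<in> N. clause_valid F P E) \<longrightarrow> clause_valid F P C)"


section \<open>Orderings\<close>

text \<open>All orderings are written as \<open>gt s t\<close> for \<open>s \<succ> t\<close>, whereas \<^const>\<open>multp\<close> takes a less-than
  relation.\<close>

definition mset_gt :: "('a \<Rightarrow> 'a \<Rightarrow> bool) \<Rightarrow> 'a multiset \<Rightarrow> 'a multiset \<Rightarrow> bool" where
  "mset_gt gt M N \<longleftrightarrow> multp gt\<inverse>\<inverse> N M"

definition simplification_ordering :: "(('f, 'v) term \<Rightarrow> ('f, 'v) term \<Rightarrow> bool) \<Rightarrow> bool" where
  "simplification_ordering gt \<longleftrightarrow>
    irreflp gt \<and> transp gt \<and> wfp gt\<inverse>\<inverse> \<and>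
    (\<forall>\<sigma> s t. gt s t \<longrightarrow> gt (subst_term \<sigma> s) (subst_term \<sigma> t)) \<and>
    (\<forall>c s t. gt s t \<longrightarrow> gt (fill_ctxt c s) (fill_ctxt c t)) \<and>
    (\<forall>c t. c \<noteq> Hole \<longrightarrow> gt (fill_ctxt c t) t)"

primrec is_equality_atom :: "('f, 'p, 'v) atom \<Rightarrow> bool" where
  "is_equality_atom (Eq e) \<longleftrightarrow> True"
| "is_equality_atom (Pred p ts) \<longleftrightarrow> False"

primrec is_equality_literal :: "('f, 'p, 'v) literal \<Rightarrow> bool" where
  "is_equality_literal (Pos A) \<longleftrightarrow> is_equality_atom A"
| "is_equality_literal (Neg A) \<longleftrightarrow> is_equality_atom A"

text \<open>\<open>gtL\<close> extends the simplification ordering \<open>gt\<close> to literals. Positive equations are compared as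
  two-element multisets. How atoms with different predicate symbols compare is left open (in practice
  this depends on, say, a predicate precedence); for atoms with a predicate symbol other than equality
  it is only required that replacing an argument by a smaller term yields a smaller atom.\<close>

definition literal_extension ::
  "(('f, 'v) term \<Rightarrow> ('f, 'v) term \<Rightarrow> bool) \<Rightarrow>
   (('f, 'p, 'v) literal \<Rightarrow> ('f, 'p, 'v) literal \<Rightarrow> bool) \<Rightarrow> bool" where
  "literal_extension gt gtL \<longleftrightarrow>
    irreflp gtL \<and> transp gtL \<and> wfp gtL\<inverse>\<inverse> \<and>
    (\<forall>\<sigma> L K. gtL L K \<longrightarrow> gtL (subst_literal \<sigma> L) (subst_literal \<sigma> K)) \<and>
    (\<forall>s t s' t'. gtL (equation s t) (equation s' t') \<longleftrightarrow> mset_gt gt {#s, t#} {#s', t'#}) \<and>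
    (\<forall>p ts s t us. gt s t \<longrightarrow> gtL (Pos (Pred p (ts @ s # us))) (Pos (Pred p (ts @ t # us)))) \<and>
    (\<forall>A. gtL (Neg A) (Pos A)) \<and>
    (\<forall>A B. gtL (Pos A) (Pos B) \<longrightarrow>
      gtL (Neg A) (Pos A) \<and> gtL (Pos A) (Neg B) \<and> gtL (Neg B) (Pos B)) \<and>
    (\<forall>L K. \<not> is_equality_literal L \<and> is_equality_literal K \<longrightarrow> gtL L K)"

abbreviation clause_gt ::
  "(('f, 'p, 'v) literal \<Rightarrow> ('f, 'p, 'v) literal \<Rightarrow> bool) \<Rightarrow>
   ('f, 'p, 'v) clause \<Rightarrow> ('f, 'p, 'v) clause \<Rightarrow> bool" where
  "clause_gt gtL \<equiv> mset_gt gtL"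


section \<open>Redundancy and simplification inferences\<close>

definition redundant ::
  "'u itself \<Rightarrow> (('f, 'p, 'v) literal \<Rightarrow> ('f, 'p, 'v) literal \<Rightarrow> bool) \<Rightarrow>
   ('f, 'p, 'v) clause set \<Rightarrow> ('f, 'p, 'v) clause \<Rightarrow> bool" where
  "redundant U gtL S C \<longleftrightarrow>
    (\<exists>N. finite N \<and> N \<subseteq> S \<and> (\<forall>E \<in> N. clause_gt gtL C E) \<and> entails U N C)"

definition instances :: "('f, 'p, 'v) clause set \<Rightarrow> ('f, 'p, 'v) clause set" where
  "instances S = {subst_clause \<sigma> C | \<sigma> C. C \<in> S}"

text \<open>Variables being universally quantified, a clause makes all its instances available for
  showing another clause redundant. A premise itself need not be smaller than the main premise, only
  the instance of it that is used.\<close>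

definition simplification_inference ::
  "'u itself \<Rightarrow> (('f, 'p, 'v) literal \<Rightarrow> ('f, 'p, 'v) literal \<Rightarrow> bool) \<Rightarrow>
   ('f, 'p, 'v) clause set \<Rightarrow> ('f, 'p, 'v) clause \<Rightarrow> ('f, 'p, 'v) clause \<Rightarrow> bool" where
  "simplification_inference U gtL premises main conclusion \<longleftrightarrow>
    main \<in> premises \<and> redundant U gtL (instances (insert conclusion premises)) main"

end

theory Submission
  imports Defs
begin

text \<open>Fix a valuation. If the literals of \<open>C\<sigma>\<close> are false, then the side premise forces
  \<open>l\<sigma>\<close> and \<open>r\<sigma>\<close> to have the same value, so \<open>L[l\<sigma>]\<close> and \<open>L[r\<sigma>]\<close> have the same
  truth value; otherwise a literal of \<open>C\<sigma>\<close>, hence of \<open>D\<close>, is true. Monotonicity of the ordering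
  makes \<open>L[r\<sigma>]\<close> smaller than \<open>L[l\<sigma>]\<close>.\<close>

text \<open>Together with the next three lemmas, this makes every clause an instance of itself, so
  that the conclusion of the inference lies in \<open>instances\<close>.\<close>

lemma subst_term_Var [simp]: "subst_term Var t = t"
  by (induction t) (auto simp: map_idI)

lemma subst_atom_Var [simp]: "subst_atom Var A = A"
proof (cases A)
  case (Eq e)
  then show ?thesis by (cases e) simp
qed (simp add: map_idI)

lemma subst_literal_Var [simp]: "subst_literal Var L = L"
  by (cases L) simp_all

lemma subst_clause_Var [simp]: "subst_clause Var C = C"
  by (simp add: subst_clause_def multiset.map_ident_strong)

text \<open>A pair may be represented as \<open>Upair s t\<close> or \<open>Upair t s\<close>; the
  existential in \<open>atom_true\<close> collapses because equality of values is symmetric.\<close>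

lemma atom_true_Eq_Upair [simp]:
  "atom_true F P v (Eq (Upair s t)) \<longleftrightarrow> eval_term F v s = eval_term F v t"
  by auto

declare atom_true.simps(1) [simp del]

lemma eval_term_subst_term:
  "eval_term F v (subst_term \<sigma> t) = eval_term F (\<lambda>x. eval_term F v (\<sigma> x)) t"
  by (induction t) (auto intro!: arg_cong[where f = "F _"])

lemma atom_true_subst_atom:
  "atom_true F P v (subst_atom \<sigma> A) \<longleftrightarrow> atom_true F P (\<lambda>x. eval_term F v (\<sigma> x)) A"
proof (cases A)
  case (Eq e)
  then show ?thesis by (cases e) (simp add: eval_term_subst_term)
qed (simp add: eval_term_subst_term comp_def)

lemma literal_true_subst_literal:
  "literal_true F P v (subst_literal \<sigma> L) \<longleftrightarrow> literal_true F P (\<lambda>x. eval_term F v (\<sigma> x)) L"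
  by (cases L) (simp_all add: atom_true_subst_atom)

text \<open>An instance under \<open>v\<close> has the truth value of \<open>C\<close> under the
  valuation sending \<open>x\<close> to the value of \<open>\<sigma> x\<close>, and validity covers
  all valuations.\<close>

lemma clause_valid_subst_clause:
  assumes "clause_valid F P C"
  shows "clause_valid F P (subst_clause \<sigma> C)"
  using assms by (simp add: clause_valid_def subst_clause_def literal_true_subst_literal)

lemma eval_term_fill_ctxt_cong:
  assumes "eval_term F v s = eval_term F v t"
  shows "eval_term F v (fill_ctxt c s) = eval_term F v (fill_ctxt c t)"
  using assms by (induction c) auto

lemma literal_true_fill_literal_ctxt_cong:
  assumes "eval_term F v s = eval_term F v t"
  shows "literal_true F P v (fill_literal_ctxt K s) \<longleftrightarrow> literal_true F P v (fill_literal_ctxt K t)"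
proof -
  have "atom_true F P v (fill_atom_ctxt a s) \<longleftrightarrow> atom_true F P v (fill_atom_ctxt a t)" for a
    by (cases a) (simp_all add: eval_term_fill_ctxt_cong[OF assms])
  then show ?thesis by (cases K) simp_all
qed

text \<open>Here \<open>t\<close>, \<open>s\<close> and \<open>C\<close> stand for l\<sigma>,
  r\<sigma> and C\<sigma>. The argument runs for each valuation separately, since the equation may
  hold at some valuations only.\<close>

lemma clause_valid_demodulation:
  assumes "clause_valid F P (add_mset (fill_literal_ctxt K s) D)"
    and "clause_valid F P (add_mset (equation t s) C)"
    and "C \<subseteq># D"
  shows "clause_valid F P (add_mset (fill_literal_ctxt K t) D)"
  unfolding clause_valid_def
proof
  fix v
  have "(\<exists>L\<in>#C. literal_true F P v L) \<or> eval_term F v t = eval_term F v s"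
    using assms(2) by (auto simp: clause_valid_def)
  moreover have "(\<exists>L\<in>#D. literal_true F P v L) \<or> literal_true F P v (fill_literal_ctxt K s)"
    using assms(1) by (auto simp: clause_valid_def)
  ultimately show "\<exists>L\<in>#add_mset (fill_literal_ctxt K t) D. literal_true F P v L"
    using literal_true_fill_literal_ctxt_cong[of F v t s P K] mset_subset_eqD[OF assms(3)]
    by auto
qed

text \<open>A single multiset step trades \<open>x\<close> for \<open>y\<close> and keeps
  \<open>M\<close>. It serves both for the two sides of an equation and for the literals of a
  clause.\<close>

lemma mset_gt_add_mset:
  assumes "gt x y"
  shows "mset_gt gt (add_mset x M) (add_mset y M)"
  using one_step_implies_multp[of "{#x#}" "{#y#}" "gt\<inverse>\<inverse>" M] assms
  by (simp add: mset_gt_def)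

lemma gt_fill_literal_ctxt:
  assumes "simplification_ordering gt" and "literal_extension gt gtL" and "gt s t"
  shows "gtL (fill_literal_ctxt K s) (fill_literal_ctxt K t)"
proof -
  have ctxt: "gt (fill_ctxt c s) (fill_ctxt c t)" for c
    using assms(1,3) by (simp add: simplification_ordering_def)
  have pos: "gtL (Pos (fill_atom_ctxt a s)) (Pos (fill_atom_ctxt a t))" for a
  proof (cases a)
    case (Eq_ctxt c u)
    \<comment> \<open>Equations compare as multisets of their sides, and the untouched side
      \<open>u\<close> is the common part.\<close>
    have "mset_gt gt {#fill_ctxt c s, u#} {#fill_ctxt c t, u#}"
      using ctxt by (rule mset_gt_add_mset)
    with Eq_ctxt show ?thesis
      using assms(2) by (simp add: literal_extension_def)
  next
    case (Pred_ctxt p ts c us)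
    with ctxt[of c] show ?thesis
      using assms(2) by (simp add: literal_extension_def)
  qed
  show ?thesis
  proof (cases K)
    case (Neg_ctxt a)
    \<comment> \<open>For negative literals the comparison passes through the larger positive atom:
      Neg A \<succ> Pos A \<succ> Neg B.\<close>
    have "transp gtL"
      using assms(2) by (simp add: literal_extension_def)
    moreover have "gtL (Neg (fill_atom_ctxt a s)) (Pos (fill_atom_ctxt a s))"
      and "gtL (Pos (fill_atom_ctxt a s)) (Neg (fill_atom_ctxt a t))"
      using assms(2) pos[of a] unfolding literal_extension_def by blast+
    ultimately show ?thesis
      using Neg_ctxt by (auto dest: transpD)
  qed (simp add: pos)
qed

theorem theorem2:
  fixes gt :: "('f, 'v) term \<Rightarrow> ('f, 'v) term \<Rightarrow> bool"
    and gtL :: "('f, 'p, 'v) literal \<Rightarrow> ('f, 'p, 'v) literal \<Rightarrow> bool"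
    and l r t :: "('f, 'v) term"
    and C D :: "('f, 'p, 'v) clause"
    and L :: "('f, 'p, 'v) literal_ctxt"
    and \<sigma> :: "('f, 'v) subst"
  defines "side \<equiv> add_mset (equation l r) C"
    and "main \<equiv> add_mset (fill_literal_ctxt L t) D"
    and "conclusion \<equiv> add_mset (fill_literal_ctxt L (subst_term \<sigma> r)) D"
    and "side_instance \<equiv> add_mset (subst_literal \<sigma> (equation l r)) (subst_clause \<sigma> C)"
  assumes "simplification_ordering gt"
    and "literal_extension gt gtL"
    and "subst_term \<sigma> l = t"
    and "subst_clause \<sigma> C \<subseteq># D"
    and "gt (subst_term \<sigma> l) (subst_term \<sigma> r)"
    and "clause_gt gtL main side_instance"
  shows "simplification_inference TYPE('u) gtL {side, main} main conclusion \<and>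
    entails TYPE('u) {conclusion, side} main \<and>
    entails TYPE('u) {conclusion, side_instance} main \<and>
    clause_gt gtL main conclusion \<and>
    clause_gt gtL main side_instance"
proof -
  have side_instance: "side_instance = subst_clause \<sigma> side"
    by (simp add: side_def side_instance_def subst_clause_def)
  have entails_instance: "entails TYPE('u) {conclusion, side_instance} main"
    using clause_valid_demodulation[OF _ _ \<open>subst_clause \<sigma> C \<subseteq># D\<close>] \<open>subst_term \<sigma> l = t\<close>
    by (auto simp: entails_def main_def conclusion_def side_instance_def)
  \<comment> \<open>Wherever \<open>side\<close> is valid, so is its instance.\<close>
  then have entails_side: "entails TYPE('u) {conclusion, side} main"
    by (simp add: entails_def side_instance clause_valid_subst_clause)
  have main_gt: "clause_gt gtL main conclusion"
    unfolding main_def conclusion_def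
    using gt_fill_literal_ctxt assms(5-7,9) by (blast intro: mset_gt_add_mset)
  have "conclusion = subst_clause Var conclusion"
    by simp
  then have "{conclusion, side_instance} \<subseteq> instances (insert conclusion {side, main})"
    unfolding instances_def side_instance by blast
  then have "redundant TYPE('u) gtL (instances (insert conclusion {side, main})) main"
    unfolding redundant_def
    using entails_instance main_gt \<open>clause_gt gtL main side_instance\<close>
    \<comment> \<open>The witness contains \<open>side_instance\<close>, not \<open>side\<close>:
      only the instance is assumed to be smaller than \<open>main\<close>.\<close>
    by (intro exI[of _ "{conclusion, side_instance}"]) simp
  then show ?thesis
    using entails_side entails_instance main_gt \<open>clause_gt gtL main side_instance\<close>
    by (simp add: simplification_inference_def)
qed

end
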